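(* Let $M=K$ be the $3$-dimensional Heisenberg group of matrices $\left[\begin{smallmatrix} 1 & 0 & 0 \\ x_2 & 1 & 0 \\ x_3 & x_1 & 1 \end{smallmatrix}\right]$ with the conformal class of $g=dx_1^2-dx_2^2+(dx_3-x_1dx_2)^2$ of signature $(1,2)$. Let $\gamma=(\gamma_1,\gamma_2,\gamma_3)$ be a curve (in the coordinates $(x_1,x_2,x_3)$) parametrized by arc-length with respect to $g$ and put $$u_1=\tfrac1{\sqrt2}(\gamma_1'-\gamma_2'),\quad u_2=\gamma_3'-\gamma_1\gamma_2',\quad u_3=\tfrac1{\sqrt2}(\gamma_1'+\gamma_2'),$$ $$a_1=-u_1u_2+u_1',\quad a_2=u_2',\quad a_3=u_3u_2+u_3'.$$ The following quantities are constant along the conformal circles on $(M,[g])$: $$C_1=\tfrac{2\sqrt2}{3}(2u_3a_1-2u_1a_3-u_2)(\gamma_1+\gamma_2)+\tfrac43(u_3-2u_3a_2+2u_2a_3),$$ \begin{align*}C_2={}&\tfrac15(2u_3a_1-2u_1a_3-u_2)(\gamma_1^2-\gamma_2^2)+\tfrac{\sqrt2}{5}\big(2u_2(a_1+a_3)-2a_2(u_1+u_3)-u_1+u_3\big)\gamma_1\\&+\tfrac{\sqrt2}{5}\big(2u_2(a_1-a_3)+2a_2(u_3-u_1)-u_1-u_3\big)\gamma_2+\tfrac85(u_3a_1-u_1a_3),\end{align*} \begin{align*}C_3={}&\tfrac14(2u_3a_1-u_2-2u_1a_3)(\gamma_1^2-\gamma_2^2)-\tfrac{\sqrt2}{4}\big(2(u_1+u_3)a_2-2(a_1+a_3)u_2+u_1-u_3\big)\gamma_1\\&-\tfrac{\sqrt2}{4}\big(2(u_1-u_3)a_2+2(a_3-a_1)u_2+u_1+u_3\big)\gamma_2+u_2,\end{align*}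 $$C_4=\tfrac{2\sqrt2}{3}(2u_1a_3-2u_3a_1+u_2)(\gamma_1-\gamma_2)+\tfrac43(2u_1a_2+u_1-2u_2a_1).$$
   Context: Conformal coframe: $e^1=\frac1{\sqrt2}(dx_1-dx_2)$, $e^2=dx_3-x_1dx_2$, $e^3=\frac1{\sqrt2}(dx_1+dx_2)$, $g=2e^1e^3+(e^2)^2$; arc-length parametrization means $2u_1u_3+u_2^2=1$. In these (non-holonomic) variables an arc-length parametrized curve is a conformal circle (of the conformal structure $[g]$, up to parametrization) if and only if $$a_1'=-u_1(2a_1a_3+a_2^2)+u_1u_2^2+\tfrac12u_1a_2+\tfrac12u_2a_1,$$ $$a_2'=-u_2(2a_1a_3+a_2^2)+u_2^3-u_2+\tfrac12u_3a_1-\tfrac12u_1a_3,$$ $$a_3'=-u_3(2a_1a_3+a_2^2)+u_3u_2^2-\tfrac12u_3a_2-\tfrac12u_2a_3,$$ where $u_1a_3+u_2a_2+u_3a_1=0$ follows from $2u_1u_3+u_2^2=1$. *)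

theory Defs
  imports "HOL-Analysis.Analysis"
begin

section \<open>Pseudo-Riemannian geometry in a global chart\<close>

text \<open>A metric on the coordinate space is given by its matrix field \<open>G\<close>;
  \<open>G x $ i $ j\<close> is the component \<open>g\<^sub>i\<^sub>j\<close> at \<open>x\<close>. Signatures are arbitrary.\<close>

type_synonym 'n metric = "real ^ 'n \<Rightarrow> real ^ 'n ^ 'n"

definition metric_ip :: "'n::finite metric \<Rightarrow> real ^ 'n \<Rightarrow> real ^ 'n \<Rightarrow> real ^ 'n \<Rightarrow> real" where
  "metric_ip G x v w = v \<bullet> (G x *v w)"

definition partial :: "'n::finite \<Rightarrow> (real ^ 'n \<Rightarrow> real) \<Rightarrow> real ^ 'n \<Rightarrow> real" where
  "partial i f x = deriv (\<lambda>h. f (x + h *\<^sub>R axis i 1)) 0"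

text \<open>\<open>christoffel G k i j\<close> has upper index \<open>k\<close>.\<close>

definition christoffel :: "'n::finite metric \<Rightarrow> 'n \<Rightarrow> 'n \<Rightarrow> 'n \<Rightarrow> real ^ 'n \<Rightarrow> real" where
  "christoffel G k i j x =
     (\<Sum>l\<in>UNIV. matrix_inv (G x) $ k $ l *
        (partial i (\<lambda>y. G y $ j $ l) x + partial j (\<lambda>y. G y $ i $ l) x
          - partial l (\<lambda>y. G y $ i $ j) x)) / 2"

text \<open>Sign convention: the round sphere has positive Ricci curvature.\<close>

definition ricci :: "'n::finite metric \<Rightarrow> real ^ 'n \<Rightarrow> real ^ 'n ^ 'n" where
  "ricci G x = (\<chi> j k.
     (\<Sum>i\<in>UNIV. partial i (christoffel G i j k) x - partial j (christoffel G i i k) x)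
     + (\<Sum>i\<in>UNIV. \<Sum>m\<in>UNIV.
          christoffel G i i m x * christoffel G m j k x
          - christoffel G i j m x * christoffel G m i k x))"

definition scalar_curvature :: "'n::finite metric \<Rightarrow> real ^ 'n \<Rightarrow> real" where
  "scalar_curvature G x = (\<Sum>i\<in>UNIV. \<Sum>j\<in>UNIV. matrix_inv (G x) $ i $ j * ricci G x $ i $ j)"

text \<open>Meaningful in dimension at least 3.\<close>

definition schouten :: "'n::finite metric \<Rightarrow> real ^ 'n \<Rightarrow> real ^ 'n ^ 'n" where
  "schouten G x = (1 / (real CARD('n) - 2)) *\<^sub>R
     (ricci G x - (scalar_curvature G x / (2 * (real CARD('n) - 1))) *\<^sub>R G x)"

section \<open>Curves and conformal circles\<close>

text \<open>Used only for open \<open>I\<close>, where the iterated two-sided derivatives are meaningful.\<close>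

definition smooth_on :: "real set \<Rightarrow> (real \<Rightarrow> 'a::real_normed_vector) \<Rightarrow> bool" where
  "smooth_on I f \<longleftrightarrow>
     (\<forall>n. \<forall>t\<in>I. ((\<lambda>h s. vector_derivative h (at s)) ^^ n) f differentiable (at t))"

definition velocity :: "(real \<Rightarrow> 'a::real_normed_vector) \<Rightarrow> real \<Rightarrow> 'a" where
  "velocity c t = vector_derivative c (at t)"

text \<open>Levi-Civita derivative along \<open>c\<close> of a vector field \<open>V\<close> along \<open>c\<close>.\<close>

definition cov_deriv ::
  "'n::finite metric \<Rightarrow> (real \<Rightarrow> real ^ 'n) \<Rightarrow> (real \<Rightarrow> real ^ 'n) \<Rightarrow> real \<Rightarrow> real ^ 'n" where
  "cov_deriv G c V t = (\<chi> k. vector_derivative V (at t) $ k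
     + (\<Sum>i\<in>UNIV. \<Sum>j\<in>UNIV. christoffel G k i j (c t) * velocity c t $ i * V t $ j))"

definition acceleration ::
  "'n::finite metric \<Rightarrow> (real \<Rightarrow> real ^ 'n) \<Rightarrow> real \<Rightarrow> real ^ 'n" where
  "acceleration G c = cov_deriv G c (velocity c)"

definition arc_length_on :: "'n::finite metric \<Rightarrow> real set \<Rightarrow> (real \<Rightarrow> real ^ 'n) \<Rightarrow> bool" where
  "arc_length_on G I c \<longleftrightarrow> (\<forall>t\<in>I. metric_ip G (c t) (velocity c t) (velocity c t) = 1)"

text \<open>The Bailey--Eastwood equation of (non-null, projectively parametrized) conformal circles,
  with \<open>u\<close> the velocity, \<open>a\<close> the acceleration and \<open>P\<close> the Schouten tensor:
  \<open>\<nabla>\<^sub>u a = 3 (u\<cdot>a)/(u\<cdot>u) a - 3/2 (a\<cdot>a)/(u\<cdot>u) u + (u\<cdot>u) P(u)\<^sup>\<sharp> - 2 P(u,u) u\<close>.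
  Its solution set does not change if the metric is rescaled by a smooth positive function, so it
  depends only on the conformal class of \<open>G\<close>.\<close>

definition param_conformal_circle_on ::
  "'n::finite metric \<Rightarrow> real set \<Rightarrow> (real \<Rightarrow> real ^ 'n) \<Rightarrow> bool" where
  "param_conformal_circle_on G I c \<longleftrightarrow> (\<forall>t\<in>I.
     let x = c t; u = velocity c t; a = acceleration G c t;
         uu = metric_ip G x u u; ua = metric_ip G x u a; aa = metric_ip G x a a;
         Pu = schouten G x *v u
     in uu \<noteq> 0 \<and>
        cov_deriv G c (acceleration G c) t =
          (3 * ua / uu) *\<^sub>R a - (3 * aa / (2 * uu)) *\<^sub>R u
          + uu *\<^sub>R (matrix_inv (G x) *v Pu) - (2 * (u \<bullet> Pu)) *\<^sub>R u)"

text \<open>Conformal circles up to parametrization. The reparametrization \<open>\<phi>\<close> is only local: a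
  projective parameter solves a Schwarzian equation and may run off to infinity inside \<open>I\<close>.\<close>

definition conformal_circle_on ::
  "'n::finite metric \<Rightarrow> real set \<Rightarrow> (real \<Rightarrow> real ^ 'n) \<Rightarrow> bool" where
  "conformal_circle_on G I c \<longleftrightarrow> smooth_on I c \<and>
     (\<forall>t\<in>I. \<exists>J \<phi>. open J \<and> connected J \<and> smooth_on J \<phi> \<and> (\<forall>s\<in>J. velocity \<phi> s \<noteq> 0)
        \<and> \<phi> ` J \<subseteq> I \<and> t \<in> \<phi> ` J \<and> param_conformal_circle_on G J (c \<circ> \<phi>))"

section \<open>The Heisenberg group\<close>

definition heis :: "real ^ 3 \<Rightarrow> real ^ 3 ^ 3" where
  "heis x = vector [vector [1, 0, 0], vector [x $ 2, 1, 0], vector [x $ 3, x $ 1, 1]]"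

definition heisenberg :: "(real ^ 3 ^ 3) set" where
  "heisenberg = range heis"

definition heis_coord :: "real ^ 3 ^ 3 \<Rightarrow> real ^ 3" where
  "heis_coord A = vector [A $ 3 $ 2, A $ 2 $ 1, A $ 3 $ 1]"

lemma heis_coord_heis: "heis_coord (heis x) = x"
  by (simp add: heis_coord_def heis_def vec_eq_iff forall_3)

text \<open>\<open>g = dx\<^sub>1\<^sup>2 - dx\<^sub>2\<^sup>2 + (dx\<^sub>3 - x\<^sub>1 dx\<^sub>2)\<^sup>2\<close>; the covector \<open>dx\<^sub>i\<close> is \<open>axis i 1\<close>.\<close>

definition heis_metric :: "3 metric" where
  "heis_metric x =
     (let dx1 = axis 1 1; dx2 = axis 2 1; e2 = axis 3 1 - x $ 1 *\<^sub>R dx2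
      in (\<chi> i j. dx1 $ i * dx1 $ j - dx2 $ i * dx2 $ j + e2 $ i * e2 $ j))"

end

theory Submission
  imports Defs
begin

text \<open>Reparametrizing by arc length turns the conformal circle equation into
  \<open>\<nabla>\<^sub>u a = \<mu> u + P(u)\<^sup>\<sharp>\<close> for an unspecified function \<open>\<mu>\<close>. In the left-invariant coframe the Schouten tensor
  is \<open>3/8 g - (e\<^sup>2)\<^sup>2\<close>, so this is an explicit system for the coframe components of \<open>u\<close> and \<open>a\<close>.
  The four quantities involve \<open>a\<close> only through \<open>u \<and> a\<close>, whose derivative does not see \<open>\<mu>\<close>; hence
  \<open>\<mu>\<close> never has to be determined.\<close>

section \<open>Velocities and covariant derivatives along a reparametrized curve\<close>

lemma smooth_on_velocity: "smooth_on I c \<Longrightarrow> smooth_on I (velocity c)"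
  unfolding smooth_on_def
proof (intro allI ballI)
  fix n t
  assume *: "\<forall>n. \<forall>t\<in>I. ((\<lambda>h s. vector_derivative h (at s)) ^^ n) c differentiable (at t)" and "t \<in> I"
  have "velocity c = (\<lambda>s. vector_derivative c (at s))"
    by (simp add: velocity_def fun_eq_iff)
  then show "((\<lambda>h s. vector_derivative h (at s)) ^^ n) (velocity c) differentiable (at t)"
    using *[rule_format, OF \<open>t \<in> I\<close>, of "Suc n"] unfolding funpow_Suc_right by simp
qed

lemma smooth_on_has_velocity:
  "smooth_on I c \<Longrightarrow> t \<in> I \<Longrightarrow> (c has_vector_derivative velocity c t) (at t)"
  unfolding smooth_on_def velocity_def
  using vector_derivative_works by (metis funpow_0)

text \<open>Formulas for fields along a curve are known only on an open set of parameters. This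
  suffices, since the covariant derivative at a point sees only the germ of the field there.\<close>

lemma cov_deriv_cong:
  assumes "\<forall>\<^sub>F r in nhds t. V r = W r"
  shows "cov_deriv G c V t = cov_deriv G c W t"
  using vector_derivative_cong_eq[where A = UNIV and B = UNIV and f = V and g = W and x = t and y = t]
    eventually_nhds_x_imp_x[OF assms] assms
  by (simp add: cov_deriv_def)

lemma cov_deriv_add:
  assumes "V differentiable (at t)" "W differentiable (at t)"
  shows "cov_deriv G c (\<lambda>r. V r + W r) t = cov_deriv G c V t + cov_deriv G c W t"
  using assms by (simp add: cov_deriv_def vec_eq_iff distrib_left sum.distrib)

lemma has_vector_derivative_scaleR_compose:
  assumes \<phi>: "(\<phi> has_vector_derivative \<phi>') (at s)"
    and f: "(f has_vector_derivative f') (at s)"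
    and V: "(V has_vector_derivative V') (at (\<phi> s))"
  shows "((\<lambda>r. f r *\<^sub>R V (\<phi> r)) has_vector_derivative
    f s *\<^sub>R \<phi>' *\<^sub>R V' + f' *\<^sub>R V (\<phi> s)) (at s)"
  using has_vector_derivative_scaleR[OF _ vector_diff_chain_at[OF \<phi> V], of f f'] f
  by (simp add: o_def has_real_derivative_iff_has_vector_derivative)

text \<open>Chain and product rule combined: the Christoffel term is linear in the velocity, so it
  picks up the factor \<phi>' exactly as the derivative of \<open>V\<close> does. It is applied with
  \<open>f\<close> equal to \<phi>', \<phi>'' and the square of \<phi>'.\<close>

lemma cov_deriv_scaleR_compose:
  assumes c: "(c has_vector_derivative velocity c (\<phi> s)) (at (\<phi> s))"
    and \<phi>: "(\<phi> has_vector_derivative \<phi>') (at s)"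
    and f: "(f has_vector_derivative f') (at s)"
    and V: "V differentiable (at (\<phi> s))"
  shows "cov_deriv G (c \<circ> \<phi>) (\<lambda>r. f r *\<^sub>R V (\<phi> r)) s =
           f' *\<^sub>R V (\<phi> s) + (f s * \<phi>') *\<^sub>R cov_deriv G c V (\<phi> s)"
proof -
  define V' where "V' = vector_derivative V (at (\<phi> s))"
  have V': "(V has_vector_derivative V') (at (\<phi> s))"
    using V unfolding V'_def by (simp add: vector_derivative_works)
  have 1: "vector_derivative (\<lambda>r. f r *\<^sub>R V (\<phi> r)) (at s) = f s *\<^sub>R \<phi>' *\<^sub>R V' + f' *\<^sub>R V (\<phi> s)"
    by (rule vector_derivative_at[OF has_vector_derivative_scaleR_compose[OF \<phi> f V']])
  have 2: "velocity (c \<circ> \<phi>) s = \<phi>' *\<^sub>R velocity c (\<phi> s)"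
    unfolding velocity_def[of "c \<circ> \<phi>"] by (rule vector_derivative_at[OF vector_diff_chain_at[OF \<phi> c]])
  show ?thesis
    unfolding cov_deriv_def 1 2 V'_def
    by (simp add: vec_eq_iff distrib_left sum_distrib_left mult_ac)
qed

section \<open>The conformal circle equation at unit speed\<close>

lemma metric_ip_scaleR_left: "metric_ip G x (r *\<^sub>R v) w = r * metric_ip G x v w"
  by (simp add: metric_ip_def)

lemma metric_ip_add_right: "metric_ip G x v (w + z) = metric_ip G x v w + metric_ip G x v z"
  by (simp add: metric_ip_def matrix_vector_right_distrib inner_add_right)

lemma metric_ip_scaleR_right: "metric_ip G x v (r *\<^sub>R w) = r * metric_ip G x v w"
  by (simp add: metric_ip_def matrix_vector_mult_scaleR)

text \<open>The projective parameter enters only through multiples of the velocity.\<close>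

lemma unit_speed_conformal_circle:
  fixes G :: "'n::finite metric"
  assumes "conformal_circle_on G I c" and "t \<in> I"
    and a: "\<And>r. r \<in> I \<Longrightarrow> acceleration G c differentiable (at r)"
    and uu: "metric_ip G (c t) (velocity c t) (velocity c t) = 1"
    and ua: "metric_ip G (c t) (velocity c t) (acceleration G c t) = 0"
  obtains \<mu> where "cov_deriv G c (acceleration G c) t =
    \<mu> *\<^sub>R velocity c t + matrix_inv (G (c t)) *v (schouten G (c t) *v velocity c t)"
proof -
  note circle = assms(1)[unfolded conformal_circle_on_def]
  from circle have c: "smooth_on I c" ..
  from bspec[OF conjunct2[OF circle] \<open>t \<in> I\<close>] obtain J \<phi> s
    where "open J" and \<phi>: "smooth_on J \<phi>" and p_ne: "\<And>r. r \<in> J \<Longrightarrow> velocity \<phi> r \<noteq> 0"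
      and "\<phi> ` J \<subseteq> I" and s: "s \<in> J" "t = \<phi> s"
      and circle: "param_conformal_circle_on G J (c \<circ> \<phi>)"
    by (elim exE conjE imageE) simp
  define p where "p = velocity \<phi>"
  define q where "q = velocity p"
  have J: "\<phi> r \<in> I" if "r \<in> J" for r using that \<open>\<phi> ` J \<subseteq> I\<close> by blast
  have D\<phi>: "(\<phi> has_vector_derivative p r) (at r)" if "r \<in> J" for r
    using smooth_on_has_velocity[OF \<phi> that] by (simp add: p_def)
  have Dp: "(p has_vector_derivative q r) (at r)" if "r \<in> J" for r
    using smooth_on_has_velocity[OF smooth_on_velocity[OF \<phi>] that] by (simp add: p_def q_def)
  have Dq: "(q has_vector_derivative velocity q r) (at r)" if "r \<in> J" for r
    using smooth_on_has_velocity[OF smooth_on_velocity[OF smooth_on_velocity[OF \<phi>]] that]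
    by (simp add: p_def q_def)
  have Dc: "(c has_vector_derivative velocity c r) (at r)" if "r \<in> I" for r
    using smooth_on_has_velocity[OF c that] .
  have Du: "velocity c differentiable (at r)" if "r \<in> I" for r
    using smooth_on_has_velocity[OF smooth_on_velocity[OF c] that] differentiableI_vector by blast
  have nhds_J: "\<forall>\<^sub>F r in nhds r0. r \<in> J" if "r0 \<in> J" for r0
    using that \<open>open J\<close> eventually_nhds_in_open by blast
  have vel: "velocity (c \<circ> \<phi>) r = p r *\<^sub>R velocity c (\<phi> r)" if "r \<in> J" for r
    unfolding velocity_def[of "c \<circ> \<phi>"]
    by (rule vector_derivative_at[OF vector_diff_chain_at[OF D\<phi>[OF that] Dc[OF J[OF that]]]])
  \<comment> \<open>One factor \<open>p\<close> rescales the velocity, the other the direction of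
    differentiation; together they give the square in front of the acceleration of
    \<open>c\<close>.\<close>
  have acc: "acceleration G (c \<circ> \<phi>) r =
      q r *\<^sub>R velocity c (\<phi> r) + (p r)\<^sup>2 *\<^sub>R acceleration G c (\<phi> r)" if "r \<in> J" for r
  proof -
    have "acceleration G (c \<circ> \<phi>) r = cov_deriv G (c \<circ> \<phi>) (\<lambda>r. p r *\<^sub>R velocity c (\<phi> r)) r"
      unfolding acceleration_def
      by (rule cov_deriv_cong) (use nhds_J[OF that] in \<open>rule eventually_mono, simp add: vel\<close>)
    then show ?thesis
      using cov_deriv_scaleR_compose[where f = p and V = "velocity c",
        OF Dc[OF J[OF that]] D\<phi>[OF that] Dp[OF that] Du[OF J[OF that]]]
      by (simp add: acceleration_def power2_eq_square)
  qed
  define u a where "u = velocity c t" and "a = acceleration G c t"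
  note uu' = uu[folded u_def] and ua' = ua[folded u_def a_def]
  define P where "P = schouten G (c t) *v u"
  \<comment> \<open>This number stays unexpanded: it enters the equation only in the coefficient of
    \<open>u\<close>.\<close>
  define b where "b = metric_ip G (c t) (acceleration G (c \<circ> \<phi>) s) (acceleration G (c \<circ> \<phi>) s)"
  have Dpp: "((\<lambda>r. (p r)\<^sup>2) has_vector_derivative 2 * p s * q s) (at s)"
    using Dp[OF s(1)] unfolding has_real_derivative_iff_has_vector_derivative[symmetric]
    by (auto intro!: derivative_eq_intros)
  have comp: "(\<lambda>r. f r *\<^sub>R V (\<phi> r)) differentiable (at s)"
    if "(f has_vector_derivative f') (at s)" "V differentiable (at (\<phi> s))"
    for f f' and V :: "real \<Rightarrow> real ^ 'n"
    by (rule differentiableI_vector[OF has_vector_derivative_scaleR_compose[OF D\<phi>[OF s(1)] that(1)]])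
      (use that(2) in \<open>simp add: vector_derivative_works\<close>)
  have "cov_deriv G (c \<circ> \<phi>) (acceleration G (c \<circ> \<phi>)) s =
      cov_deriv G (c \<circ> \<phi>) (\<lambda>r. q r *\<^sub>R velocity c (\<phi> r) + (p r)\<^sup>2 *\<^sub>R acceleration G c (\<phi> r)) s"
    by (rule cov_deriv_cong) (use nhds_J[OF s(1)] in \<open>rule eventually_mono, simp add: acc\<close>)
  also have "\<dots> = cov_deriv G (c \<circ> \<phi>) (\<lambda>r. q r *\<^sub>R velocity c (\<phi> r)) s
      + cov_deriv G (c \<circ> \<phi>) (\<lambda>r. (p r)\<^sup>2 *\<^sub>R acceleration G c (\<phi> r)) s"
    by (intro cov_deriv_add comp[OF Dq[OF s(1)]] comp[OF Dpp] Du a J s)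
  also have "\<dots> = velocity q s *\<^sub>R u + (q s * p s) *\<^sub>R a
      + ((2 * p s * q s) *\<^sub>R a + ((p s)\<^sup>2 * p s) *\<^sub>R cov_deriv G c (acceleration G c) t)"
    using cov_deriv_scaleR_compose[where f = q and V = "velocity c",
        OF Dc[OF J] D\<phi> Dq Du[OF J], OF s(1) s(1) s(1) s(1)]
      cov_deriv_scaleR_compose[where f = "\<lambda>r. (p r)\<^sup>2" and V = "acceleration G c",
        OF Dc[OF J] D\<phi> Dpp a[OF J], OF s(1) s(1) s(1)]
    by (simp add: s(2) u_def a_def acceleration_def)
  finally have lhs: "cov_deriv G (c \<circ> \<phi>) (acceleration G (c \<circ> \<phi>)) s =
      velocity q s *\<^sub>R u + (3 * p s * q s) *\<^sub>R a + (p s)^3 *\<^sub>R cov_deriv G c (acceleration G c) t"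
    by (simp add: algebra_simps power3_eq_cube power2_eq_square flip: scaleR_add_left)
  \<comment> \<open>The total coefficient of \<open>u\<close>: three terms from the right-hand side
    of the circle equation, and \<open>velocity q s\<close> moved over from the left.\<close>
  define k where "k = 3 * (q s)\<^sup>2 / p s - 3 * b / (2 * p s) - 2 * (p s)^3 * (u \<bullet> P) - velocity q s"
  have p: "p s \<noteq> 0" using p_ne[OF s(1)] by (simp add: p_def)
  have "cov_deriv G (c \<circ> \<phi>) (acceleration G (c \<circ> \<phi>)) s =
      (3 * (p s * q s) / (p s)\<^sup>2) *\<^sub>R (q s *\<^sub>R u + (p s)\<^sup>2 *\<^sub>R a) - (3 * b / (2 * (p s)\<^sup>2)) *\<^sub>R p s *\<^sub>R u
      + (p s)\<^sup>2 *\<^sub>R p s *\<^sub>R (matrix_inv (G (c t)) *v P) - (2 * ((p s)\<^sup>2 * (u \<bullet> P))) *\<^sub>R p s *\<^sub>R u"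
    using circle[unfolded param_conformal_circle_on_def, rule_format, OF s(1)]
    by (simp add: Let_def b_def s(2)[symmetric] vel[OF s(1)] acc[OF s(1)] metric_ip_scaleR_left
        metric_ip_scaleR_right metric_ip_add_right ua' uu' matrix_vector_mult_scaleR P_def power2_eq_square
        flip: u_def a_def)
  also have "\<dots> = (3 * (q s)\<^sup>2 / p s - 3 * b / (2 * p s) - 2 * (p s)^3 * (u \<bullet> P)) *\<^sub>R u
      + (3 * p s * q s) *\<^sub>R a + (p s)^3 *\<^sub>R (matrix_inv (G (c t)) *v P)"
    using p by (simp add: vec_eq_iff power2_eq_square power3_eq_cube field_simps)
  finally have rhs: "cov_deriv G (c \<circ> \<phi>) (acceleration G (c \<circ> \<phi>)) s = \<dots>" .
  \<comment> \<open>Because \<open>u\<close> is a unit vector orthogonal to \<open>a\<close>, the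
    term \<open>(3 * p s * q s) *\<^sub>R a\<close> occurs identically on both sides and cancels.
    Only multiples of \<open>u\<close> and the Schouten term survive.\<close>
  have "(p s)^3 *\<^sub>R cov_deriv G c (acceleration G c) t =
      k *\<^sub>R u + (p s)^3 *\<^sub>R (matrix_inv (G (c t)) *v P)"
    using rhs[unfolded lhs]
    unfolding k_def by (simp add: algebra_simps del: scaleR_scaleR)
  then have "(1 / (p s)^3) *\<^sub>R (p s)^3 *\<^sub>R cov_deriv G c (acceleration G c) t =
      (1 / (p s)^3) *\<^sub>R (k *\<^sub>R u + (p s)^3 *\<^sub>R (matrix_inv (G (c t)) *v P))"
    by (rule arg_cong)
  then have "cov_deriv G c (acceleration G c) t = (k / (p s)^3) *\<^sub>R u + matrix_inv (G (c t)) *v P"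
    using p by (simp add: scaleR_add_right)
  then show thesis
    using that unfolding P_def u_def by blast
qed

section \<open>Christoffel symbols and curvature of the Heisenberg metric\<close>

text \<open>The metric coefficients, and hence the Christoffel symbols, depend on the first
  coordinate alone. This reduces all partial derivatives to ordinary ones.\<close>

lemma partial_fst_coordinate:
  fixes h :: "real \<Rightarrow> real" and x :: "real ^ 3"
  assumes "(h has_real_derivative h') (at (x $ 1))"
  shows "partial i (\<lambda>y. h (y $ 1)) x = (if i = 1 then h' else 0)"
proof -
  have "((\<lambda>r. x $ 1 + r * axis i 1 $ 1) has_real_derivative axis i 1 $ 1) (at 0)"
    by (auto intro!: derivative_eq_intros)
  then have "((\<lambda>r. h (x $ 1 + r * axis i 1 $ 1)) has_real_derivative h' * axis i 1 $ 1) (at 0)"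
    using DERIV_chain2[where f = h and g = "\<lambda>r. x $ 1 + r * axis i 1 $ 1" and x = 0] assms by simp
  then show ?thesis
    unfolding partial_def by (simp add: DERIV_imp_deriv axis_def)
qed

lemma heis_metric_matrix:
  "heis_metric x = vector [vector [1, 0, 0], vector [0, (x $ 1)\<^sup>2 - 1, - x $ 1], vector [0, - x $ 1, 1]]"
  by (simp add: heis_metric_def Let_def vec_eq_iff forall_3 axis_def power2_eq_square)

text \<open>\<open>matrix_inv\<close> is a Hilbert choice; \<open>B\<close> witnesses that a
  two-sided inverse exists, and associativity makes it unique.\<close>

lemma matrix_inv_eqI:
  fixes A :: "real ^ 'n ^ 'm"
  assumes "A ** B = mat 1" and "B ** A = mat 1"
  shows "matrix_inv A = B"
proof -
  have "A ** matrix_inv A = mat 1 \<and> matrix_inv A ** A = mat 1"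
    unfolding matrix_inv_def by (rule someI[where x = B]) (use assms in blast)
  then show ?thesis
    by (metis assms(1) matrix_mul_assoc matrix_mul_lid matrix_mul_rid)
qed

lemma matrix_inv_heis_metric:
  "matrix_inv (heis_metric x) =
     vector [vector [1, 0, 0], vector [0, - 1, - x $ 1], vector [0, - x $ 1, 1 - (x $ 1)\<^sup>2]]"
  by (rule matrix_inv_eqI)
    (simp_all add: heis_metric_matrix matrix_matrix_mult_def mat_def vec_eq_iff forall_3 sum_3
      power2_eq_square algebra_simps)

lemma partial_heis_metric:
  "partial l (\<lambda>y. heis_metric y $ i $ j) x = (if l = 1 then
     vector [vector [0, 0, 0], vector [0, 2 * x $ 1, - 1], vector [0, - 1, 0 :: real]] $ i $ j else 0)"
proof -
  have "((\<lambda>r. vector [vector [1, 0, 0], vector [0, r\<^sup>2 - 1, - r], vector [0, - r, 1 :: real]] $ i $ j)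
     has_real_derivative
       vector [vector [0, 0, 0], vector [0, 2 * x $ 1, - 1], vector [0, - 1, 0]] $ i $ j) (at (x $ 1))"
    using exhaust_3[of i] exhaust_3[of j] by (auto intro!: derivative_eq_intros)
  from partial_fst_coordinate[where
      h = "\<lambda>r. vector [vector [1, 0, 0], vector [0, r\<^sup>2 - 1, - r], vector [0, - r, 1 :: real]] $ i $ j",
      OF this]
  show ?thesis unfolding heis_metric_matrix .
qed

text \<open>The outermost index is the upper one. The table is a function of the single number
  \<open>x $ 1\<close>, so that it can be differentiated as a function of one real variable.\<close>

definition heis_christoffel :: "real \<Rightarrow> real ^ 3 ^ 3 ^ 3" where
  "heis_christoffel r = vector
    [vector [vector [0, 0, 0], vector [0, - r, 1 / 2], vector [0, 1 / 2, 0]],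
     vector [vector [0, - r / 2, 1 / 2], vector [- r / 2, 0, 0], vector [1 / 2, 0, 0]],
     vector [vector [0, - (1 + r\<^sup>2) / 2, r / 2], vector [- (1 + r\<^sup>2) / 2, 0, 0], vector [r / 2, 0, 0]]]"

lemma christoffel_heis_metric:
  "christoffel heis_metric k i j x = heis_christoffel (x $ 1) $ k $ i $ j"
  using exhaust_3[of i] exhaust_3[of j] exhaust_3[of k]
  by (auto simp: christoffel_def heis_christoffel_def matrix_inv_heis_metric partial_heis_metric sum_3
      power2_eq_square algebra_simps)

lemma has_real_derivative_heis_christoffel:
  "((\<lambda>r. heis_christoffel r $ k $ i $ j) has_real_derivative
     vector
    [vector [vector [0, 0, 0], vector [0, - 1, 0], vector [0, 0, 0]],
     vector [vector [0, - 1 / 2, 0], vector [- 1 / 2, 0, 0], vector [0, 0, 0]],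
     vector [vector [0, - r, 1 / 2], vector [- r, 0, 0], vector [1 / 2, 0, 0 :: real]]] $ k $ i $ j) (at r)"
  using exhaust_3[of i] exhaust_3[of j] exhaust_3[of k]
  by (auto simp: heis_christoffel_def intro!: derivative_eq_intros)

lemma partial_christoffel_heis_metric:
  "partial l (christoffel heis_metric k i j) x = (if l = 1 then
     vector
    [vector [vector [0, 0, 0], vector [0, - 1, 0], vector [0, 0, 0]],
     vector [vector [0, - 1 / 2, 0], vector [- 1 / 2, 0, 0], vector [0, 0, 0]],
     vector [vector [0, - x $ 1, 1 / 2], vector [- x $ 1, 0, 0], vector [1 / 2, 0, 0 :: real]]] $ k $ i $ j
     else 0)"
  unfolding christoffel_heis_metric
  by (rule partial_fst_coordinate[OF has_real_derivative_heis_christoffel])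

text \<open>Invariantly, this tensor is g/2 - (e^2)^2 with e^2 = dx_3 - x_1 dx_2.\<close>

lemma ricci_heis_metric:
  "ricci heis_metric x = vector [vector [1 / 2, 0, 0],
     vector [0, - (1 + (x $ 1)\<^sup>2) / 2, x $ 1 / 2], vector [0, x $ 1 / 2, - 1 / 2]]"
  by (simp add: ricci_def vec_eq_iff forall_3 sum_3 partial_christoffel_heis_metric
      christoffel_heis_metric heis_christoffel_def power2_eq_square field_simps)

lemma scalar_curvature_heis_metric: "scalar_curvature heis_metric x = 1 / 2"
  by (simp add: scalar_curvature_def ricci_heis_metric matrix_inv_heis_metric sum_3
      power2_eq_square field_simps)

text \<open>In dimension 3 with scalar curvature 1/2, the Schouten tensor is the Ricci tensor minus
  g/8, that is, 3/8 g - (e^2)^2.\<close>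

lemma schouten_heis_metric:
  "schouten heis_metric x = vector [vector [3 / 8, 0, 0],
     vector [0, - 3 / 8 - 5 / 8 * (x $ 1)\<^sup>2, 5 / 8 * x $ 1], vector [0, 5 / 8 * x $ 1, - 5 / 8]]"
  by (simp add: schouten_def ricci_heis_metric scalar_curvature_heis_metric heis_metric_matrix
      vec_eq_iff forall_3 power2_eq_square field_simps)

section \<open>The left-invariant coframe and differentiation along curves\<close>

text \<open>The components e^1(v), e^2(v), e^3(v) in a left-invariant coframe with two null members,
  in which g = 2 e^1 e^3 + (e^2)^2.\<close>

definition heis_coframe :: "real ^ 3 \<Rightarrow> real ^ 3 \<Rightarrow> real ^ 3" where
  "heis_coframe x v =
     vector [(v $ 1 - v $ 2) / sqrt 2, v $ 3 - x $ 1 * v $ 2, (v $ 1 + v $ 2) / sqrt 2]"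

lemma metric_ip_heis_metric:
  "metric_ip heis_metric x v w =
     heis_coframe x v $ 1 * heis_coframe x w $ 3 + heis_coframe x v $ 2 * heis_coframe x w $ 2
     + heis_coframe x v $ 3 * heis_coframe x w $ 1"
  by (simp add: metric_ip_def heis_coframe_def inner_vec_def matrix_vector_mult_def sum_3
      heis_metric_matrix power2_eq_square field_simps)

lemma heis_coframe_sum: "(heis_coframe x v $ 3 + heis_coframe x v $ 1) / sqrt 2 = v $ 1"
  by (simp add: heis_coframe_def field_simps)

lemma heis_coframe_diff: "(heis_coframe x v $ 3 - heis_coframe x v $ 1) / sqrt 2 = v $ 2"
  by (simp add: heis_coframe_def field_simps)

lemma linear_heis_coframe: "linear (heis_coframe x)"
  by (rule linearI) (simp_all add: heis_coframe_def vec_eq_iff forall_3 add_divide_distrib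
      diff_divide_distrib algebra_simps)

text \<open>The metric part of the Schouten tensor returns a multiple of \<open>v\<close>. Since e^2
  has unit length and is orthogonal to e^1 and e^3, raising its index gives the frame vector with
  components \<open>axis 2 1\<close>.\<close>

lemma heis_coframe_schouten:
  "heis_coframe x (matrix_inv (heis_metric x) *v (schouten heis_metric x *v v)) =
     (3 / 8) *\<^sub>R heis_coframe x v - heis_coframe x v $ 2 *\<^sub>R axis 2 1"
  by (simp add: heis_coframe_def matrix_inv_heis_metric schouten_heis_metric axis_def
      matrix_vector_mult_def sum_3 vec_eq_iff forall_3 power2_eq_square field_simps)

lemma has_real_derivative_vec_nth:
  "(c has_vector_derivative c') (at t) \<Longrightarrow> ((\<lambda>s. c s $ i) has_real_derivative c' $ i) (at t)"
  unfolding has_real_derivative_iff_has_vector_derivative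
  by (rule bounded_linear.has_vector_derivative[OF bounded_linear_vec_nth])

lemma has_real_derivative_imp_differentiable:
  "(f has_real_derivative f') (at t) \<Longrightarrow> f differentiable (at t)"
  unfolding has_real_derivative_iff_has_vector_derivative by (rule differentiableI_vector)

text \<open>Supplies the differentiability needed to differentiate the acceleration once more; the
  Christoffel symbols are polynomials in the first coordinate.\<close>

lemma acceleration_heis_metric_differentiable:
  assumes c: "smooth_on I c" and t: "t \<in> I"
  shows "acceleration heis_metric c differentiable (at t)"
proof -
  note c' = smooth_on_velocity[OF c]
  have 0: "((\<lambda>s. c s $ 1) has_real_derivative velocity c t $ 1) (at t)"
    by (intro has_real_derivative_vec_nth smooth_on_has_velocity[OF c t])
  have 1: "((\<lambda>s. velocity c s $ i) has_real_derivative velocity (velocity c) t $ i) (at t)" for i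
    by (intro has_real_derivative_vec_nth smooth_on_has_velocity[OF c' t])
  have 2: "((\<lambda>s. vector_derivative (velocity c) (at s) $ i) has_real_derivative
      velocity (velocity (velocity c)) t $ i) (at t)" for i
    using has_real_derivative_vec_nth[OF smooth_on_has_velocity[OF smooth_on_velocity[OF c'] t]]
    by (simp add: velocity_def[of "velocity c"])
  have 3: "(\<lambda>s. heis_christoffel (c s $ 1) $ k $ i $ j) differentiable (at t)" for k i j
    using DERIV_chain2[OF has_real_derivative_heis_christoffel 0]
      has_real_derivative_imp_differentiable by blast
  have "(\<lambda>s. acceleration heis_metric c s \<bullet> axis k 1) differentiable (at t)" for k
    unfolding acceleration_def cov_deriv_def inner_axis christoffel_heis_metric vec_lambda_beta
      inner_real_def
    by (intro differentiable_add differentiable_sum differentiable_mult differentiable_const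
        finite ballI 1[THEN has_real_derivative_imp_differentiable]
        2[THEN has_real_derivative_imp_differentiable] 3)
  then show ?thesis
    by (subst differentiable_componentwise_within) (auto simp: Basis_vec_def)
qed

text \<open>The Levi-Civita connection in the coframe. By left invariance its coefficients are
  constants, so the corrections are bilinear in the components of the velocity and of
  \<open>V\<close>, without the base point.\<close>

lemma heis_coframe_has_derivative:
  fixes c :: "real \<Rightarrow> real ^ 3"
  defines "e \<equiv> \<lambda>t. heis_coframe (c t)"
  assumes c: "(c has_vector_derivative velocity c t) (at t)" and V: "V differentiable (at t)"
  shows "((\<lambda>s. e s (V s) $ 1) has_real_derivative e t (cov_deriv heis_metric c V t) $ 1
      + (e t (velocity c t) $ 1 * e t (V t) $ 2 + e t (velocity c t) $ 2 * e t (V t) $ 1) / 2) (at t)"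
    and "((\<lambda>s. e s (V s) $ 2) has_real_derivative e t (cov_deriv heis_metric c V t) $ 2
      + (e t (velocity c t) $ 3 * e t (V t) $ 1 - e t (velocity c t) $ 1 * e t (V t) $ 3) / 2) (at t)"
    and "((\<lambda>s. e s (V s) $ 3) has_real_derivative e t (cov_deriv heis_metric c V t) $ 3
      - (e t (velocity c t) $ 3 * e t (V t) $ 2 + e t (velocity c t) $ 2 * e t (V t) $ 3) / 2) (at t)"
proof -
  \<comment> \<open>Here \<open>r\<close> is 1 / sqrt 2, kept abstract so that only the polynomial
    relation \<open>2 * r * r = 1\<close> remains.\<close>
  obtain r where r: "x / sqrt 2 = r * x" "2 * r * r = 1" for x
    using that[of "1 / sqrt 2"] by simp
  \<comment> \<open>The antisymmetric combination of the e^1 and e^3 components is the coordinate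
    determinant that comes from differentiating the factor \<open>c s $ 1\<close> in e^2 and from
    the Christoffel terms.\<close>
  have rr: "(r * (a + b)) * (r * (a' - b')) - (r * (a - b)) * (r * (a' + b')) = b * a' - a * b'" for a b a' b'
    using r(2) by algebra
  note 0 = has_real_derivative_vec_nth[OF c]
    and 1 = has_real_derivative_vec_nth[OF V[unfolded vector_derivative_works]]
  note simps = e_def heis_coframe_def cov_deriv_def christoffel_heis_metric heis_christoffel_def sum_3 r(1)
  show "((\<lambda>s. e s (V s) $ 1) has_real_derivative e t (cov_deriv heis_metric c V t) $ 1
      + (e t (velocity c t) $ 1 * e t (V t) $ 2 + e t (velocity c t) $ 2 * e t (V t) $ 1) / 2) (at t)"
    unfolding e_def heis_coframe_def vector_3 r(1)
    by (rule derivative_eq_intros 0 1 refl)+ (simp add: simps algebra_simps add_divide_distrib diff_divide_distrib)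
  show "((\<lambda>s. e s (V s) $ 2) has_real_derivative e t (cov_deriv heis_metric c V t) $ 2
      + (e t (velocity c t) $ 3 * e t (V t) $ 1 - e t (velocity c t) $ 1 * e t (V t) $ 3) / 2) (at t)"
    unfolding e_def heis_coframe_def vector_3 r(1)
    by (rule derivative_eq_intros 0 1 refl)+
      (unfold rr, simp add: simps algebra_simps power2_eq_square add_divide_distrib diff_divide_distrib)
  show "((\<lambda>s. e s (V s) $ 3) has_real_derivative e t (cov_deriv heis_metric c V t) $ 3
      - (e t (velocity c t) $ 3 * e t (V t) $ 2 + e t (velocity c t) $ 2 * e t (V t) $ 3) / 2) (at t)"
    unfolding e_def heis_coframe_def vector_3 r(1)
    by (rule derivative_eq_intros 0 1 refl)+ (simp add: simps algebra_simps add_divide_distrib diff_divide_distrib)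
qed

section \<open>The system of differential equations and its first integrals\<close>

lemma constant_on_if_has_real_derivative_0:
  fixes f :: "real \<Rightarrow> real"
  assumes "open I" "connected I" "\<And>t. t \<in> I \<Longrightarrow> (f has_real_derivative 0) (at t)"
  shows "f constant_on I"
  using has_field_derivative_zero_constant[of I f] assms
  by (auto simp: constant_on_def connected_convex_1 has_field_derivative_at_within)

text \<open>The theorem after translation into coframe components. The function \<mu> is arbitrary,
  as it only adds a multiple of (u1, u2, u3) to the derivative of (a1, a2, a3).\<close>

lemma heis_first_integrals:
  fixes g1 g2 u1 u2 u3 a1 a2 a3 :: "real \<Rightarrow> real"
  assumes I: "open I" "connected I"
    and speed: "\<And>t. t \<in> I \<Longrightarrow> 2 * u1 t * u3 t + (u2 t)\<^sup>2 = 1"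
    and orth: "\<And>t. t \<in> I \<Longrightarrow> u1 t * a3 t + u2 t * a2 t + u3 t * a1 t = 0"
    and g1: "\<And>t. t \<in> I \<Longrightarrow> (g1 has_real_derivative (u3 t + u1 t) / sqrt 2) (at t)"
    and g2: "\<And>t. t \<in> I \<Longrightarrow> (g2 has_real_derivative (u3 t - u1 t) / sqrt 2) (at t)"
    and u1: "\<And>t. t \<in> I \<Longrightarrow> (u1 has_real_derivative a1 t + u1 t * u2 t) (at t)"
    and u2: "\<And>t. t \<in> I \<Longrightarrow> (u2 has_real_derivative a2 t) (at t)"
    and u3: "\<And>t. t \<in> I \<Longrightarrow> (u3 has_real_derivative a3 t - u3 t * u2 t) (at t)"
    and a1: "\<And>t. t \<in> I \<Longrightarrow> (a1 has_real_derivative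
      \<mu> t * u1 t + (u1 t * a2 t + u2 t * a1 t) / 2) (at t)"
    and a2: "\<And>t. t \<in> I \<Longrightarrow> (a2 has_real_derivative
      \<mu> t * u2 t - u2 t + (u3 t * a1 t - u1 t * a3 t) / 2) (at t)"
    and a3: "\<And>t. t \<in> I \<Longrightarrow> (a3 has_real_derivative
      \<mu> t * u3 t - (u3 t * a2 t + u2 t * a3 t) / 2) (at t)"
  shows
    "(\<lambda>t. 2 * sqrt 2 / 3 * (2 * u3 t * a1 t - 2 * u1 t * a3 t - u2 t) * (g1 t + g2 t)
        + 4 / 3 * (u3 t - 2 * u3 t * a2 t + 2 * u2 t * a3 t)) constant_on I" (is "?C1 constant_on I")
    "(\<lambda>t. 1 / 5 * (2 * u3 t * a1 t - 2 * u1 t * a3 t - u2 t) * ((g1 t)^2 - (g2 t)^2)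
        + sqrt 2 / 5 * (2 * u2 t * (a1 t + a3 t) - 2 * a2 t * (u1 t + u3 t) - u1 t + u3 t) * g1 t
        + sqrt 2 / 5 * (2 * u2 t * (a1 t - a3 t) + 2 * a2 t * (u3 t - u1 t) - u1 t - u3 t) * g2 t
        + 8 / 5 * (u3 t * a1 t - u1 t * a3 t)) constant_on I" (is "?C2 constant_on I")
    "(\<lambda>t. 1 / 4 * (2 * u3 t * a1 t - u2 t - 2 * u1 t * a3 t) * ((g1 t)^2 - (g2 t)^2)
        - sqrt 2 / 4 * (2 * (u1 t + u3 t) * a2 t - 2 * (a1 t + a3 t) * u2 t + u1 t - u3 t) * g1 t
        - sqrt 2 / 4 * (2 * (u1 t - u3 t) * a2 t + 2 * (a3 t - a1 t) * u2 t + u1 t + u3 t) * g2 t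
        + u2 t) constant_on I" (is "?C3 constant_on I")
    "(\<lambda>t. 2 * sqrt 2 / 3 * (2 * u1 t * a3 t - 2 * u3 t * a1 t + u2 t) * (g1 t - g2 t)
        + 4 / 3 * (2 * u1 t * a2 t + u1 t - 2 * u2 t * a1 t)) constant_on I" (is "?C4 constant_on I")
proof -
  \<comment> \<open>Modulo the speed relation, \<open>K' = 0\<close>, \<open>L1' = K u3\<close>, \<open>L3' = K u1\<close>, \<open>p' = \<surd>2 u3\<close>,
    \<open>m' = \<surd>2 u1\<close> and \<open>L3 u3 + L1 u1 = 2 u2'\<close>; every first integral is a polynomial in these.\<close>
  define K L1 L3 p m where
    "K = (\<lambda>t. 2 * (u3 t * a1 t - u1 t * a3 t) - u2 t)" and
    "L1 = (\<lambda>t. 2 * (u3 t * a2 t - u2 t * a3 t) - u3 t)" and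
    "L3 = (\<lambda>t. 2 * (u1 t * a2 t - u2 t * a1 t) + u1 t)" and
    "p = (\<lambda>t. g1 t + g2 t)" and "m = (\<lambda>t. g1 t - g2 t)"
  note defs = K_def L1_def L3_def p_def m_def
  have half: "x / sqrt 2 = sqrt 2 * x / 2" for x
    by (simp add: field_simps)
  \<comment> \<open>The \<mu> terms cancel by antisymmetry. Then \<open>orth\<close> replaces u3 a1
    + u1 a3 by - u2 a2, and \<open>speed\<close> reduces the rest to the derivative of u2, which the
    last term of \<open>K\<close> removes.\<close>
  have DK: "(K has_real_derivative 0) (at t)" if "t \<in> I" for t
    unfolding defs
    by (rule derivative_eq_intros u1 u2 u3 a1 a2 a3 that refl)+
      (use speed[OF that] orth[OF that] in algebra)
  have DL1: "(L1 has_real_derivative K t * u3 t) (at t)" if "t \<in> I" for t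
    unfolding defs
    by (rule derivative_eq_intros u1 u2 u3 a1 a2 a3 that refl)+
      (use speed[OF that] orth[OF that] in algebra)
  have DL3: "(L3 has_real_derivative K t * u1 t) (at t)" if "t \<in> I" for t
    unfolding defs
    by (rule derivative_eq_intros u1 u2 u3 a1 a2 a3 that refl)+
      (use speed[OF that] orth[OF that] in algebra)
  have Dp: "(p has_real_derivative sqrt 2 * u3 t) (at t)" if "t \<in> I" for t
    unfolding defs by (rule derivative_eq_intros g1 g2 that refl)+
      (simp add: half ring_distribs diff_divide_distrib add_divide_distrib)
  have Dm: "(m has_real_derivative sqrt 2 * u1 t) (at t)" if "t \<in> I" for t
    unfolding defs by (rule derivative_eq_intros g1 g2 that refl)+
      (simp add: half ring_distribs diff_divide_distrib add_divide_distrib)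
  have L: "L3 t * u3 t + L1 t * u1 t = 2 * a2 t" if "t \<in> I" for t
    using speed[OF that] orth[OF that] unfolding defs by algebra
  note D = DK DL1 DL3 Dp Dm u2
  have C1: "?C1 = (\<lambda>t. 2 * sqrt 2 / 3 * K t * p t - 4 / 3 * L1 t)"
    by (simp add: fun_eq_iff defs algebra_simps)
  \<comment> \<open>The difference of squares is \<open>p t * m t\<close>. Comparison with the form
    of \<open>?C3\<close> below shows that \<open>?C2\<close> is 4/5 times the sum of
    \<open>?C3\<close> and \<open>K\<close>.\<close>
  have C2: "?C2 = (\<lambda>t. 1 / 5 * K t * (p t * m t)
      - sqrt 2 / 5 * (L3 t * p t + L1 t * m t) + 4 / 5 * (K t + u2 t))"
    by (simp add: fun_eq_iff defs algebra_simps power2_eq_square add_divide_distrib diff_divide_distrib)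
  have C3: "?C3 = (\<lambda>t. 1 / 4 * K t * (p t * m t) - sqrt 2 / 4 * (L3 t * p t + L1 t * m t) + u2 t)"
    by (simp add: fun_eq_iff defs algebra_simps power2_eq_square add_divide_distrib diff_divide_distrib)
  have C4: "?C4 = (\<lambda>t. 4 / 3 * L3 t - 2 * sqrt 2 / 3 * K t * m t)"
    by (simp add: fun_eq_iff defs algebra_simps)
  have s: "sqrt 2 * (sqrt 2 * x) = 2 * x" for x by (simp add: mult.assoc[symmetric])
  show "?C1 constant_on I" unfolding C1
    by (rule constant_on_if_has_real_derivative_0[OF I])
      ((rule derivative_eq_intros D refl | assumption)+, simp add: s algebra_simps)
  show "?C4 constant_on I" unfolding C4
    by (rule constant_on_if_has_real_derivative_0[OF I])
      ((rule derivative_eq_intros D refl | assumption)+, simp add: s algebra_simps)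
  \<comment> \<open>The terms containing \<open>K\<close> cancel in the derivative. What remains is
    a multiple of L3 u3 + L1 u1, which \<open>L\<close> balances against the derivative of
    u2.\<close>
  show "?C2 constant_on I" unfolding C2
    by (rule constant_on_if_has_real_derivative_0[OF I], (rule derivative_eq_intros D refl | assumption)+,
      drule L, simp add: s algebra_simps)
  show "?C3 constant_on I" unfolding C3
    by (rule constant_on_if_has_real_derivative_0[OF I], (rule derivative_eq_intros D refl | assumption)+,
      drule L, simp add: s algebra_simps)
qed

section \<open>Unit-speed conformal circles of the Heisenberg metric as solutions of this
  system\<close>

theorem proposition5p2:
  fixes I :: "real set" and c :: "real \<Rightarrow> real ^ 3 ^ 3" and \<gamma> :: "real \<Rightarrow> real ^ 3"
    and \<gamma>1 \<gamma>2 \<gamma>3 u1 u2 u3 a1 a2 a3 :: "real \<Rightarrow> real"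
  assumes "open I" and "connected I"
    and "\<And>t. t \<in> I \<Longrightarrow> c t \<in> heisenberg"
    and "\<gamma> = (\<lambda>t. heis_coord (c t))"
    and "\<gamma>1 = (\<lambda>t. \<gamma> t $ 1)" and "\<gamma>2 = (\<lambda>t. \<gamma> t $ 2)" and "\<gamma>3 = (\<lambda>t. \<gamma> t $ 3)"
    and "arc_length_on heis_metric I \<gamma>"
    and "conformal_circle_on heis_metric I \<gamma>"
    and "u1 = (\<lambda>t. 1 / sqrt 2 * (deriv \<gamma>1 t - deriv \<gamma>2 t))"
    and "u2 = (\<lambda>t. deriv \<gamma>3 t - \<gamma>1 t * deriv \<gamma>2 t)"
    and "u3 = (\<lambda>t. 1 / sqrt 2 * (deriv \<gamma>1 t + deriv \<gamma>2 t))"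
    and "a1 = (\<lambda>t. - u1 t * u2 t + deriv u1 t)"
    and "a2 = (\<lambda>t. deriv u2 t)"
    and "a3 = (\<lambda>t. u3 t * u2 t + deriv u3 t)"
  shows
    "(\<lambda>t. 2 * sqrt 2 / 3 * (2 * u3 t * a1 t - 2 * u1 t * a3 t - u2 t) * (\<gamma>1 t + \<gamma>2 t)
        + 4 / 3 * (u3 t - 2 * u3 t * a2 t + 2 * u2 t * a3 t)) constant_on I
     \<and> (\<lambda>t. 1 / 5 * (2 * u3 t * a1 t - 2 * u1 t * a3 t - u2 t) * ((\<gamma>1 t)^2 - (\<gamma>2 t)^2)
        + sqrt 2 / 5 * (2 * u2 t * (a1 t + a3 t) - 2 * a2 t * (u1 t + u3 t) - u1 t + u3 t) * \<gamma>1 t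
        + sqrt 2 / 5 * (2 * u2 t * (a1 t - a3 t) + 2 * a2 t * (u3 t - u1 t) - u1 t - u3 t) * \<gamma>2 t
        + 8 / 5 * (u3 t * a1 t - u1 t * a3 t)) constant_on I
     \<and> (\<lambda>t. 1 / 4 * (2 * u3 t * a1 t - u2 t - 2 * u1 t * a3 t) * ((\<gamma>1 t)^2 - (\<gamma>2 t)^2)
        - sqrt 2 / 4 * (2 * (u1 t + u3 t) * a2 t - 2 * (a1 t + a3 t) * u2 t + u1 t - u3 t) * \<gamma>1 t
        - sqrt 2 / 4 * (2 * (u1 t - u3 t) * a2 t + 2 * (a3 t - a1 t) * u2 t + u1 t + u3 t) * \<gamma>2 t
        + u2 t) constant_on I
     \<and> (\<lambda>t. 2 * sqrt 2 / 3 * (2 * u1 t * a3 t - 2 * u3 t * a1 t + u2 t) * (\<gamma>1 t - \<gamma>2 t)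
        + 4 / 3 * (2 * u1 t * a2 t + u1 t - 2 * u2 t * a1 t)) constant_on I"
proof -
  note \<gamma>12 = assms(5,6) and arc = assms(8) and circle = assms(9)
  have smooth: "smooth_on I \<gamma>"
    using circle by (simp add: conformal_circle_on_def)
  define U A where "U = (\<lambda>t. heis_coframe (\<gamma> t) (velocity \<gamma> t))"
    and "A = (\<lambda>t. heis_coframe (\<gamma> t) (acceleration heis_metric \<gamma> t))"
  have D\<gamma>: "(\<gamma> has_vector_derivative velocity \<gamma> t) (at t)" if "t \<in> I" for t
    by (rule smooth_on_has_velocity[OF smooth that])
  have Du: "velocity \<gamma> differentiable (at t)" if "t \<in> I" for t
    by (rule differentiableI_vector[OF smooth_on_has_velocity[OF smooth_on_velocity[OF smooth] that]])
  have Da: "acceleration heis_metric \<gamma> differentiable (at t)" if "t \<in> I" for t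
    by (rule acceleration_heis_metric_differentiable[OF smooth that])
  \<comment> \<open>With the velocity as the field, the connection terms are u1 u2, 0 and - u3 u2.
    This is why the given a1, a2, a3 are the coframe components of the acceleration.\<close>
  have DU: "((\<lambda>s. U s $ 1) has_real_derivative A t $ 1 + U t $ 1 * U t $ 2) (at t)"
    "((\<lambda>s. U s $ 2) has_real_derivative A t $ 2) (at t)"
    "((\<lambda>s. U s $ 3) has_real_derivative A t $ 3 - U t $ 3 * U t $ 2) (at t)" if "t \<in> I" for t
    using heis_coframe_has_derivative[OF D\<gamma> Du, OF that that]
    by (simp_all add: U_def A_def acceleration_def algebra_simps)
  have u: "u1 t = U t $ 1" "u2 t = U t $ 2" "u3 t = U t $ 3" if "t \<in> I" for t
    using has_real_derivative_vec_nth[OF D\<gamma>[OF that], THEN DERIV_imp_deriv]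
    by (simp_all add: assms(5-7,10-12) U_def heis_coframe_def)
  \<comment> \<open>The functions u1, u2, u3 are identified with the components of \<open>U\<close>
    on \<open>I\<close> only, so openness of \<open>I\<close> is what carries the derivatives
    over.\<close>
  have deriv_u: "deriv f t = D" if "t \<in> I" "\<And>t. t \<in> I \<Longrightarrow> f t = g t" "(g has_real_derivative D) (at t)"
    for f g and t D :: real
    by (rule DERIV_imp_deriv, rule has_field_derivative_transform_within_open[OF that(3) \<open>open I\<close> that(1)])
      (simp add: that(2))
  have a: "a1 t = A t $ 1" "a2 t = A t $ 2" "a3 t = A t $ 3" if "t \<in> I" for t
    unfolding assms(13-15) using deriv_u[OF that u(1) DU(1)[OF that]]
      deriv_u[OF that u(2) DU(2)[OF that]] deriv_u[OF that u(3) DU(3)[OF that]] u[OF that]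
    by simp_all
  have speed: "2 * U t $ 1 * U t $ 3 + (U t $ 2)\<^sup>2 = 1" if "t \<in> I" for t
    using arc that by (simp add: arc_length_on_def metric_ip_heis_metric U_def power2_eq_square
        mult.assoc)
  \<comment> \<open>This is half the derivative of the arc-length condition, in which the connection
    terms cancel.\<close>
  have orth: "U t $ 1 * A t $ 3 + U t $ 2 * A t $ 2 + U t $ 3 * A t $ 1 = 0" if "t \<in> I" for t
  proof -
    have "((\<lambda>t. 2 * U t $ 1 * U t $ 3 + (U t $ 2)\<^sup>2) has_real_derivative
        2 * (U t $ 1 * A t $ 3 + U t $ 2 * A t $ 2 + U t $ 3 * A t $ 1)) (at t)"
      by (rule derivative_eq_intros DU that refl)+ (simp add: algebra_simps)
    moreover have "((\<lambda>t. 2 * U t $ 1 * U t $ 3 + (U t $ 2)\<^sup>2) has_real_derivative 0) (at t)"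
      by (rule has_field_derivative_transform_within_open[OF DERIV_const \<open>open I\<close> that]) (simp add: speed)
    ultimately show ?thesis
      using DERIV_unique by fastforce
  qed
  \<comment> \<open>The projective parameter is local and may change with \<open>t\<close>, so \<mu>
    is found point by point and then assembled by choice; only its values enter the system.\<close>
  have "\<forall>t\<in>I. \<exists>\<mu>. heis_coframe (\<gamma> t) (cov_deriv heis_metric \<gamma> (acceleration heis_metric \<gamma>) t) =
      \<mu> *\<^sub>R U t - U t $ 2 *\<^sub>R axis 2 1"
  proof
    fix t
    assume t: "t \<in> I"
    have "metric_ip heis_metric (\<gamma> t) (velocity \<gamma> t) (velocity \<gamma> t) = 1"
      using arc t by (simp add: arc_length_on_def)
    moreover have "metric_ip heis_metric (\<gamma> t) (velocity \<gamma> t) (acceleration heis_metric \<gamma> t) = 0"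
      using orth[OF t] by (simp add: metric_ip_heis_metric U_def A_def)
    ultimately obtain \<mu> where
      "cov_deriv heis_metric \<gamma> (acceleration heis_metric \<gamma>) t = \<mu> *\<^sub>R velocity \<gamma> t
        + matrix_inv (heis_metric (\<gamma> t)) *v (schouten heis_metric (\<gamma> t) *v velocity \<gamma> t)"
      using unit_speed_conformal_circle[OF circle t Da] by blast
    \<comment> \<open>The part 3/8 g of the Schouten tensor is absorbed into \<mu>.\<close>
    then have "heis_coframe (\<gamma> t) (cov_deriv heis_metric \<gamma> (acceleration heis_metric \<gamma>) t) =
        (\<mu> + 3 / 8) *\<^sub>R U t - U t $ 2 *\<^sub>R axis 2 1"
      by (simp add: linear_add[OF linear_heis_coframe] linear_scale[OF linear_heis_coframe]
          heis_coframe_schouten U_def scaleR_add_left)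
    then show "\<exists>\<mu>. heis_coframe (\<gamma> t) (cov_deriv heis_metric \<gamma> (acceleration heis_metric \<gamma>) t) =
        \<mu> *\<^sub>R U t - U t $ 2 *\<^sub>R axis 2 1" ..
  qed
  from bchoice[OF this] obtain \<mu> where \<mu>: "\<forall>t\<in>I.
      heis_coframe (\<gamma> t) (cov_deriv heis_metric \<gamma> (acceleration heis_metric \<gamma>) t) =
        \<mu> t *\<^sub>R U t - U t $ 2 *\<^sub>R axis 2 1" ..
  have U_eq: "heis_coframe (\<gamma> t) (velocity \<gamma> t) = U t"
    and A_eq: "heis_coframe (\<gamma> t) (acceleration heis_metric \<gamma> t) = A t" for t
    by (simp_all add: U_def A_def)
  \<comment> \<open>The same connection formulas, now with the acceleration as the field; the
    Schouten term contributes \<open>- U t $ 2\<close> to the middle component.\<close>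
  have DA: "((\<lambda>s. A s $ 1) has_real_derivative
      \<mu> t * U t $ 1 + (U t $ 1 * A t $ 2 + U t $ 2 * A t $ 1) / 2) (at t)"
    "((\<lambda>s. A s $ 2) has_real_derivative
      \<mu> t * U t $ 2 - U t $ 2 + (U t $ 3 * A t $ 1 - U t $ 1 * A t $ 3) / 2) (at t)"
    "((\<lambda>s. A s $ 3) has_real_derivative
      \<mu> t * U t $ 3 - (U t $ 3 * A t $ 2 + U t $ 2 * A t $ 3) / 2) (at t)" if "t \<in> I" for t
    using heis_coframe_has_derivative[OF D\<gamma> Da, OF that that]
    unfolding U_eq A_eq bspec[OF \<mu> that] by (simp_all add: axis_def)
  have D\<gamma>1: "(\<gamma>1 has_real_derivative (U t $ 3 + U t $ 1) / sqrt 2) (at t)"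
    and D\<gamma>2: "(\<gamma>2 has_real_derivative (U t $ 3 - U t $ 1) / sqrt 2) (at t)" if "t \<in> I" for t
    using has_real_derivative_vec_nth[OF D\<gamma>[OF that]]
    unfolding U_def heis_coframe_sum heis_coframe_diff \<gamma>12 by blast+
  note integrals = heis_first_integrals[OF assms(1,2) speed orth D\<gamma>1 D\<gamma>2 DU DA]
  have cong: "f constant_on I" if "g constant_on I" "\<And>t. t \<in> I \<Longrightarrow> f t = g t" for f g :: "real \<Rightarrow> real"
    using that by (simp add: constant_on_def)
  show ?thesis
    by (rule conjI[OF cong[OF integrals(1)] conjI[OF cong[OF integrals(2)]
            conjI[OF cong[OF integrals(3)] cong[OF integrals(4)]]]])
      (simp_all add: u a)
qed

end
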